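(* Let $n\ge 1$, let $\Omega\subset\mathbb{R}^n$ be an open, bounded, convex set, and let $f:\Omega\to\mathbb{R}$ be a $C^2$ convex function which has a unique minimum point in $\Omega$ (hence a unique critical point), with minimum value $0$. For $\varepsilon\ge 0$ write $S(\varepsilon)=\{x\in\Omega:|f(x)|\le\varepsilon\}$. Let $l>0$ be such that $S(l)$ is compact and the function $y\mapsto |S(y)|$ is concave on $[0,l]$. Let $a:[0,l]\to\mathbb{C}$ be a $C^1$ function, and let $\eta(x)=a(f(x))$ for $x\in S(l)$. For real $\lambda\neq 0$ define $$I(\lambda)=\int_{S(l)}\eta(x)e^{i\lambda f(x)}\,dx.$$ Then for every real $\lambda\ne 0$, $$|I(\lambda)|\le 5n\left(\|a\|_{L^\infty[0,l]}+\|a'\|_{L^1[0,l]}\right)\left|S\!\left(\omega_n^{-1/n}/|\lambda|\right)\right|.$$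
   Context: For a measurable set $A\subset\mathbb{R}^n$, $|A|$ denotes its Lebesgue measure. $\omega_n$ denotes the Lebesgue measure (volume) of the unit ball in $\mathbb{R}^n$. *)

theory Defs
  imports "HOL-Analysis.Analysis" "HOL-Probability.Essential_Supremum"
begin

definition C2_on :: "'a::real_normed_vector set \<Rightarrow> ('a \<Rightarrow> real) \<Rightarrow> bool" where
  "C2_on \<Omega> f \<longleftrightarrow>
    (\<exists>(D :: 'a \<Rightarrow> 'a \<Rightarrow>\<^sub>L real) (H :: 'a \<Rightarrow> 'a \<Rightarrow>\<^sub>L 'a \<Rightarrow>\<^sub>L real).
      (\<forall>x\<in>\<Omega>. (f has_derivative blinfun_apply (D x)) (at x)) \<and>
      (\<forall>x\<in>\<Omega>. (D has_derivative blinfun_apply (H x)) (at x)) \<and>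
      continuous_on \<Omega> H)"

definition sublevel :: "'a set \<Rightarrow> ('a \<Rightarrow> real) \<Rightarrow> real \<Rightarrow> 'a set" where
  "sublevel \<Omega> f \<epsilon> = {x \<in> \<Omega>. \<bar>f x\<bar> \<le> \<epsilon>}"

definition osc_integral ::
  "'a::euclidean_space set \<Rightarrow> ('a \<Rightarrow> complex) \<Rightarrow> ('a \<Rightarrow> real) \<Rightarrow> real \<Rightarrow> complex" where
  "osc_integral A \<eta> f s =
    (LINT x:A|lebesgue. \<eta> x * exp (\<i> * complex_of_real (s * f x)))"

(* The two norms below are real-valued: they are meant for essentially bounded,
   respectively integrable, functions, and carry no meaning otherwise. *)

definition Linf_norm :: "real set \<Rightarrow> (real \<Rightarrow> 'b::real_normed_vector) \<Rightarrow> real" where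
  "Linf_norm A g = real_of_ereal (esssup (lebesgue_on A) (\<lambda>t. ereal (norm (g t))))"

definition L1_norm :: "real set \<Rightarrow> (real \<Rightarrow> 'b::real_normed_vector) \<Rightarrow> real" where
  "L1_norm A g = (LINT t:A|lebesgue. norm (g t))"

definition ball_vol :: "'a::euclidean_space itself \<Rightarrow> real" where
  "ball_vol _ = measure lebesgue (ball (0::'a) 1)"

end

theory Submission
  imports Defs
begin

text \<open>
  Write \<open>\<mu> y\<close> for the measure of the sublevel set at height \<open>y\<close>. The integrand depends on \<open>x\<close> only
  through \<open>f x\<close>, so the oscillatory integral is the Stieltjes integral of
  \<open>g t = a t * exp (\<i> * s * t)\<close> against \<open>\<mu>\<close>. Concavity of \<open>\<mu>\<close> says that the density of this
  measure decreases, and that at height \<open>\<delta>\<close> it is at most \<open>\<mu> \<delta> / \<delta>\<close>.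

  The sublevel set of height \<open>\<delta>\<close> contributes at most \<open>C * \<mu> \<delta>\<close>, where \<open>C\<close> is the supremum norm of
  \<open>a\<close>. On the remaining range \<open>{\<delta><..l}\<close> the second mean value theorem bounds the integral by
  the density at \<open>\<delta>\<close> times the supremum of the increments from \<open>\<delta>\<close> of a primitive \<open>G\<close> of \<open>g\<close>
  (\<open>pushforward_integral_bound\<close>). One integration by parts bounds these increments by
  \<open>(2 * C + L) / \<bar>s\<bar>\<close>, where \<open>L\<close> is the \<open>L\<^sup>1\<close> norm of \<open>a'\<close> (\<open>oscillatory_primitive\<close>).

  Let \<open>\<omega>\<close> be the volume of the unit ball in dimension \<open>n\<close>.
  For \<open>\<delta> = \<omega> powr (- 1 / n) / \<bar>s\<bar>\<close> the second contribution is therefore at most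
  \<open>\<omega> powr (1 / n) * (2 * C + L) * \<mu> \<delta>\<close>. The unit ball lies in a cube of side \<open>2\<close>, so
  \<open>\<omega> powr (1 / n) \<le> 2\<close> (\<open>ball_vol_le_cube\<close>), and the sum is at most \<open>(5 * C + 2 * L) * \<mu> \<delta>\<close>.
  If \<open>\<delta> \<ge> l\<close>, the trivial bound \<open>C * \<mu> l \<le> C * \<mu> \<delta>\<close> is enough.
\<close>

section \<open>The second mean value theorem for a concave distribution function\<close>

text \<open>
  The discrete second mean value theorem: summation by parts moves the differences from \<open>u\<close> to the
  weights \<open>d\<close>, whose decrements are nonnegative and, together with the last weight, add up to \<open>d 0\<close>.
\<close>

lemma abel_summation_bound:
  fixes u :: "nat \<Rightarrow> 'a::real_normed_vector" and d :: "nat \<Rightarrow> real"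
  assumes "u 0 = 0" and "\<And>k. k \<le> n \<Longrightarrow> norm (u k) \<le> B"
    and "\<And>k. k < n \<Longrightarrow> d (Suc k) \<le> d k" and "d n \<ge> 0"
  shows "norm (\<Sum>k<n. d k *\<^sub>R (u (Suc k) - u k)) \<le> d 0 * B"
proof -
  have rest: "norm ((\<Sum>k<m. d k *\<^sub>R (u (Suc k) - u k)) - d m *\<^sub>R u m) \<le> (d 0 - d m) * B"
    if "m \<le> n" for m
    using that
  proof (induction m)
    case 0
    then show ?case using assms(1) by simp
  next
    case (Suc m)
    have step: "norm ((d m - d (Suc m)) *\<^sub>R u (Suc m)) \<le> (d m - d (Suc m)) * B"
      using assms(2)[of "Suc m"] assms(3)[of m] Suc.prems by (simp add: mult_left_mono)
    have "(\<Sum>k<Suc m. d k *\<^sub>R (u (Suc k) - u k)) - d (Suc m) *\<^sub>R u (Suc m)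
        = ((\<Sum>k<m. d k *\<^sub>R (u (Suc k) - u k)) - d m *\<^sub>R u m)
          + (d m - d (Suc m)) *\<^sub>R u (Suc m)"
      by (simp add: algebra_simps)
    then have "norm ((\<Sum>k<Suc m. d k *\<^sub>R (u (Suc k) - u k)) - d (Suc m) *\<^sub>R u (Suc m))
        \<le> (d 0 - d m) * B + (d m - d (Suc m)) * B"
      using norm_triangle_mono[OF Suc.IH[OF Suc_leD[OF Suc.prems]] step] by (simp only:)
    then show ?case by (simp add: algebra_simps)
  qed
  have "norm (d n *\<^sub>R u n) \<le> d n * B"
    using assms(2)[of n] assms(4) by (simp add: mult_left_mono)
  with rest[of n] show ?thesis
    using norm_triangle_ineq[of "(\<Sum>k<n. d k *\<^sub>R (u (Suc k) - u k)) - d n *\<^sub>R u n" "d n *\<^sub>R u n"]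
    by (simp add: algebra_simps)
qed

lemma set_integral_norm_le_const:
  fixes g :: "'x \<Rightarrow> 'b::{banach, second_countable_topology}"
  assumes "P \<in> fmeasurable M" and "set_integrable M P g"
    and "\<And>x. x \<in> P \<Longrightarrow> norm (g x) \<le> c"
  shows "norm (LINT x:P|M. g x) \<le> c * measure M P"
proof -
  have P: "P \<in> sets M" "emeasure M P \<noteq> \<infinity>"
    using fmeasurableD2[OF assms(1)] assms(1) by auto
  have int: "set_integrable M P (\<lambda>_. c)"
    using P by (simp add: set_integrable_def top.not_eq_extremum)
  have "norm (LINT x:P|M. g x) \<le> (LINT x:P|M. norm (g x))"
    by (rule set_integral_norm_bound[OF assms(2)])
  also have "\<dots> \<le> (LINT x:P|M. c)"
    by (rule set_integral_mono[OF set_integrable_norm[OF assms(2)] int assms(3)])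
  finally show ?thesis
    using P by (simp add: set_integral_const mult.commute)
qed

text \<open>
  Here \<open>\<mu>\<close> is the distribution function of \<open>f\<close>. Instead of differentiating \<open>\<mu>\<close>, the proof cuts
  \<open>{\<delta>..l}\<close> into \<open>n\<close> intervals of equal length \<open>h\<close>. On the part of \<open>A\<close> that \<open>f\<close> maps into the
  \<open>k\<close>-th interval, \<open>g (f x)\<close> is close to the mean \<open>(G (t (Suc k)) - G (t k)) / h\<close>, by uniform
  continuity. The integral is thus close to the sum of \<open>d k *\<^sub>R (G (t (Suc k)) - G (t k))\<close>, where
  \<open>d k\<close> is the difference quotient of \<open>\<mu>\<close> over the \<open>k\<close>-th interval. These quotients decrease because
  \<open>\<mu>\<close> is concave, and \<open>abel_summation_bound\<close> applies.
\<close>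

lemma pushforward_integral_bound:
  fixes N :: "'x measure" and A :: "'x set" and f :: "'x \<Rightarrow> real" and g G :: "real \<Rightarrow> 'b::{banach, second_countable_topology}"
  defines "\<mu> \<equiv> \<lambda>y. measure N {x \<in> A. f x \<le> y}"
  assumes meas: "\<And>y. y \<in> {0..l} \<Longrightarrow> {x \<in> A. f x \<le> y} \<in> fmeasurable N"
    and conc: "concave_on {0..l} \<mu>"
    and \<delta>: "0 < \<delta>" "\<delta> < l"
    and int: "set_integrable N {x \<in> A. \<delta> < f x \<and> f x \<le> l} (\<lambda>x. g (f x))"
    and cont: "continuous_on {\<delta>..l} g"
    and G: "\<And>t. t \<in> {\<delta>..l} \<Longrightarrow> (G has_vector_derivative g t) (at t within {\<delta>..l})"
    and B: "\<And>t. t \<in> {\<delta>..l} \<Longrightarrow> norm (G t - G \<delta>) \<le> B"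
  shows "norm (LINT x:{x \<in> A. \<delta> < f x \<and> f x \<le> l}|N. g (f x)) \<le> B * \<mu> \<delta> / \<delta>"
    (is "norm ?I \<le> _")
proof -
  have approx: "norm ?I \<le> B * \<mu> \<delta> / \<delta> + e * \<mu> l" if e: "e > 0" for e
  proof -
    (* The mesh h is below the modulus of uniform continuity of g for e. *)
    have "uniformly_continuous_on {\<delta>..l} g"
      using cont by (simp add: compact_uniformly_continuous)
    then obtain r where r: "r > 0"
      "\<And>s t. \<lbrakk>s \<in> {\<delta>..l}; t \<in> {\<delta>..l}; dist s t < r\<rbrakk> \<Longrightarrow> dist (g s) (g t) < e"
      unfolding uniformly_continuous_on_def using e by meson
    obtain n :: nat where n: "real n > (l - \<delta>) / r"
      using reals_Archimedean2 by blast
    have n0: "n > 0"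
      using n \<delta> r(1) by (cases n) (auto simp: field_simps)
    define h where "h = (l - \<delta>) / real n"
    have h: "0 < h" "h < r" "real n * h = l - \<delta>"
      using n n0 \<delta> r(1) by (auto simp: h_def field_simps)
    define t where "t k = \<delta> + real k * h" for k
    have t0: "t 0 = \<delta>" and tn: "t n = l" and tSuc: "\<And>k. t (Suc k) = t k + h"
      using h by (auto simp: t_def algebra_simps)
    have tge: "\<delta> \<le> t k" for k using h by (simp add: t_def)
    have tle: "t k \<le> l" if "k \<le> n" for k
    proof -
      have "real k * h \<le> real n * h" using that h by (intro mult_right_mono) auto
      then show ?thesis using h by (simp add: t_def)
    qed
    have tin: "t k \<in> {\<delta>..l}" "t k \<in> {0..l}" if "k \<le> n" for k
      using tge[of k] tle[OF that] \<delta> by auto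
    define P where "P k = {x \<in> A. t k < f x \<and> f x \<le> t (Suc k)}" for k
    define w where "w k = (1 / h) *\<^sub>R (G (t (Suc k)) - G (t k))" for k
    (* Ending the weights with d n = 0 makes the last decrement nonnegative by monotonicity of \<mu>. *)
    define d where "d k = (if k < n then (\<mu> (t (Suc k)) - \<mu> (t k)) / h else 0)" for k
    have \<mu>_mono: "\<mu> x \<le> \<mu> y" if "0 \<le> x" "x \<le> y" "y \<le> l" for x y
      unfolding \<mu>_def using that meas[of x] meas[of y]
      by (intro measure_mono_fmeasurable) (auto dest: fmeasurableD)
    have t_meas: "{x \<in> A. f x \<le> t k} \<in> fmeasurable N" if "k \<le> n" for k
      using meas tin(2)[OF that] .
    (* A piece is a difference of sublevel sets, so its measure is an increment of \<mu>. *)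
    have P_eq: "P k = {x \<in> A. f x \<le> t (Suc k)} - {x \<in> A. f x \<le> t k}" for k
      by (auto simp: P_def)
    have P_meas: "P k \<in> fmeasurable N" if "k < n" for k
      unfolding P_eq using that t_meas[of k] t_meas[of "Suc k"]
      by (intro fmeasurable_Diff) (auto dest: fmeasurableD)
    have P_measure: "measure N (P k) = \<mu> (t (Suc k)) - \<mu> (t k)" if "k < n" for k
      unfolding P_eq \<mu>_def using that t_meas[of k] t_meas[of "Suc k"] h tSuc[of k]
        fmeasurableD2[OF t_meas[of "Suc k"]]
      by (intro measure_Diff) (auto dest: fmeasurableD)
    have tmono: "t j \<le> t k" if "j \<le> k" for j k
      using that h by (simp add: t_def mult_right_mono)
    have disj: "disjoint_family_on P {..<n}"
    proof -
      have "P j \<inter> P k = {}" if "j < k" for j k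
        using tmono[of "Suc j" k] that by (auto simp: P_def)
      then show ?thesis
        unfolding disjoint_family_on_def by (metis Int_commute linorder_neqE_nat)
    qed
    have cover: "{x \<in> A. \<delta> < f x \<and> f x \<le> l} = (\<Union>k<n. P k)"
    proof -
      have "\<exists>k<m. t k < s \<and> s \<le> t (Suc k)" if "\<delta> < s" "s \<le> t m" for s m
        using that
      proof (induction m)
        case (Suc m) then show ?case
          by (cases "s \<le> t m") (auto intro: less_SucI)
      qed (simp add: t0)
      then have "x \<in> (\<Union>k<n. P k)" if "x \<in> A" "\<delta> < f x" "f x \<le> l" for x
        using that tn by (fastforce simp: P_def)
      moreover have "\<delta> < f x \<and> f x \<le> l" if "k < n" "x \<in> P k" for k x
        using that tge[of k] tle[of "Suc k"] by (auto simp: P_def)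
      ultimately show ?thesis by (auto simp: P_def)
    qed
    have P_int: "set_integrable N (P k) (\<lambda>x. g (f x))" if "k < n" for k
      using int by (rule set_integrable_subset) (use that P_meas cover in auto)
    have split: "?I = (\<Sum>k<n. LINT x:P k|N. g (f x))"
      unfolding cover by (rule set_integral_finite_Union) (use disj P_int P_meas in auto)

    have osc: "norm (g (f x) - w k) \<le> e" if "k < n" "x \<in> P k" for k x
    proof -
      have fx: "f x \<in> {t k..t (Suc k)}" using that by (auto simp: P_def)
      have sub: "{t k..t (Suc k)} \<subseteq> {\<delta>..l}"
        using tge[of k] tle[of "Suc k"] that by auto
      have "norm (G (t (Suc k)) - G (t k) - (t (Suc k) - t k) *\<^sub>R g (f x))
          \<le> norm (t (Suc k) - t k) * e"
      proof (rule vector_differentiable_bound_linearization[where S = "{t k..t (Suc k)}"])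
        show "(G has_vector_derivative g s) (at s within {t k..t (Suc k)})"
          if "s \<in> {t k..t (Suc k)}" for s
          using G[of s] sub that has_vector_derivative_within_subset by blast
        show "closed_segment (t k) (t (Suc k)) \<subseteq> {t k..t (Suc k)}"
          using h tSuc[of k] by (simp add: closed_segment_eq_real_ivl)
        show "norm (g s - g (f x)) \<le> e" if "s \<in> {t k..t (Suc k)}" for s
        proof -
          have "dist s (f x) < r"
            using that fx tSuc[of k] h by (auto simp: dist_real_def)
          then have "dist (g s) (g (f x)) < e"
            using r(2)[of s "f x"] sub that fx by blast
          then show ?thesis by (simp add: dist_norm)
        qed
      qed (use fx in auto)
      then have *: "norm (G (t (Suc k)) - G (t k) - h *\<^sub>R g (f x)) \<le> h * e"
        using h by (simp add: tSuc)
      have "G (t (Suc k)) - G (t k) - h *\<^sub>R g (f x) = - (h *\<^sub>R (g (f x) - w k))"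
        using h by (simp add: w_def algebra_simps)
      with * h show ?thesis by simp
    qed
    have piece: "norm ((LINT x:P k|N. g (f x)) - d k *\<^sub>R (G (t (Suc k)) - G (t k)))
        \<le> e * (\<mu> (t (Suc k)) - \<mu> (t k))" if "k < n" for k
    proof -
      have fin: "P k \<in> sets N" "emeasure N (P k) < \<infinity>"
        using P_meas[OF that] fmeasurableD2[of "P k" N] by (auto simp: top.not_eq_extremum)
      have wint: "set_integrable N (P k) (\<lambda>_. w k)"
        using fin by (simp add: set_integrable_def)
      have "(LINT x:P k|N. g (f x) - w k) = (LINT x:P k|N. g (f x)) - measure N (P k) *\<^sub>R w k"
        using fin by (simp add: set_integral_diff[OF P_int[OF that] wint] set_integral_const)
      also have "measure N (P k) *\<^sub>R w k = d k *\<^sub>R (G (t (Suc k)) - G (t k))"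
        using that by (simp add: P_measure d_def w_def)
      finally show ?thesis
        using set_integral_norm_le_const[OF P_meas[OF that] set_integral_diff(1)[OF P_int[OF that] wint]
            osc[OF that]] P_measure[OF that] by simp
    qed

    have abel: "norm (\<Sum>k<n. d k *\<^sub>R (G (t (Suc k)) - G (t k))) \<le> d 0 * B"
    proof -
      have "norm (\<Sum>k<n. d k *\<^sub>R ((G (t (Suc k)) - G \<delta>) - (G (t k) - G \<delta>))) \<le> d 0 * B"
      proof (rule abel_summation_bound[where u = "\<lambda>k. G (t k) - G \<delta>"])
        show "d (Suc k) \<le> d k" if "k < n" for k
        proof (cases "Suc k < n")
          case True
          (* Midpoint concavity at three consecutive nodes. *)
          have "(1 - 1/2) * \<mu> (t k) + 1/2 * \<mu> (t (Suc (Suc k)))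
              \<le> \<mu> ((1 - 1/2) *\<^sub>R t k + (1/2) *\<^sub>R t (Suc (Suc k)))"
            by (rule concave_onD[OF conc]) (use tin True in auto)
          also have "(1 - 1/2) *\<^sub>R t k + (1/2) *\<^sub>R t (Suc (Suc k)) = t (Suc k)"
            by (simp add: tSuc algebra_simps)
          finally have "\<mu> (t (Suc (Suc k))) - \<mu> (t (Suc k)) \<le> \<mu> (t (Suc k)) - \<mu> (t k)"
            by simp
          then show ?thesis using True that h by (simp add: d_def divide_right_mono)
        next
          case False
          then show ?thesis
            using that h tge[of k] tle[of "Suc k"] \<mu>_mono[of "t k" "t (Suc k)"] \<delta>
            by (auto simp: d_def tSuc)
        qed
      qed (use t0 tin B in \<open>auto simp: d_def\<close>)
      then show ?thesis by simp
    qed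
    have d0: "d 0 \<le> \<mu> \<delta> / \<delta>"
    proof -
      (* \<delta> divides {0..\<delta> + h} in the ratio \<theta>; concavity together with \<mu> 0 \<ge> 0 compares the
         first quotient with the slope of the chord from the origin. *)
      define \<theta> where "\<theta> = \<delta> / (\<delta> + h)"
      have \<theta>: "0 \<le> \<theta>" "\<theta> \<le> 1" "\<theta> * (\<delta> + h) = \<delta>"
        using \<delta> h by (auto simp: \<theta>_def)
      have "\<delta> + h \<in> {0..l}" using tin(2)[of 1] n0 by (simp add: t_def)
      then have "(1 - \<theta>) * \<mu> 0 + \<theta> * \<mu> (\<delta> + h) \<le> \<mu> ((1 - \<theta>) *\<^sub>R 0 + \<theta> *\<^sub>R (\<delta> + h))"
        by (intro concave_onD[OF conc]) (use \<theta> \<delta> in auto)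
      moreover have "0 \<le> (1 - \<theta>) * \<mu> 0" using \<theta> by (simp add: \<mu>_def)
      ultimately have "\<theta> * \<mu> (\<delta> + h) \<le> \<mu> \<delta>" using \<theta> by simp
      then have "\<delta> * (\<mu> (\<delta> + h) - \<mu> \<delta>) \<le> h * \<mu> \<delta>"
        using \<delta> h by (simp add: \<theta>_def field_simps)
      then show ?thesis
        using n0 \<delta> h by (simp add: d_def tSuc t0 field_simps)
    qed
    have "B \<ge> 0" using B[of \<delta>] \<delta> by simp

    have "norm (?I - (\<Sum>k<n. d k *\<^sub>R (G (t (Suc k)) - G (t k))))
        \<le> (\<Sum>k<n. e * (\<mu> (t (Suc k)) - \<mu> (t k)))"
      unfolding split sum_subtractf[symmetric]
      by (intro sum_norm_le) (use piece in auto)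
    also have "\<dots> = e * (\<mu> l - \<mu> \<delta>)"
      by (simp add: sum_distrib_left[symmetric] sum_lessThan_telescope[of "\<lambda>k. \<mu> (t k)"] t0 tn)
    also have "\<dots> \<le> e * \<mu> l" using e by (simp add: \<mu>_def)
    finally have "norm ?I \<le> e * \<mu> l + d 0 * B"
      using abel norm_triangle_sub[of ?I "\<Sum>k<n. d k *\<^sub>R (G (t (Suc k)) - G (t k))"] by linarith
    also have "\<dots> \<le> e * \<mu> l + \<mu> \<delta> / \<delta> * B"
      using d0 \<open>B \<ge> 0\<close> by (intro add_left_mono mult_right_mono)
    finally show ?thesis by (simp add: mult.commute)
  qed
  show ?thesis
  proof (rule field_le_epsilon)
    fix e :: real assume "e > 0"
    have "\<mu> l \<ge> 0" by (simp add: \<mu>_def)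
    then have "e / (\<mu> l + 1) * \<mu> l \<le> e"
      using \<open>e > 0\<close> by (simp add: field_simps)
    with approx[of "e / (\<mu> l + 1)"] \<open>\<mu> l \<ge> 0\<close> \<open>e > 0\<close>
    show "norm ?I \<le> B * \<mu> \<delta> / \<delta> + e" by fastforce
  qed
qed

section \<open>The amplitude and its oscillating primitive\<close>

text \<open>
  The points where \<open>norm (a t)\<close> does not exceed the essential supremum form a closed set of full
  measure, hence all of \<open>{0..l}\<close>. The essential supremum is finite because \<open>a\<close> is bounded on
  \<open>{0..l}\<close>, so its conversion to a real number preserves its value.
\<close>

lemma norm_le_Linf_norm:
  fixes a :: "real \<Rightarrow> 'b::euclidean_space"
  assumes "continuous_on {0..l} a" and "l > 0" and t: "t \<in> {0..l}"
  shows "norm (a t) \<le> Linf_norm {0..l} a"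
proof -
  define F where "F s = ereal (norm (a s))" for s
  define E where "E = esssup (lebesgue_on {0..l}) F"
  have contF: "continuous_on {0..l} F"
    unfolding F_def using assms(1) by (intro continuous_on_ereal continuous_intros)
  have measF: "F \<in> borel_measurable (lebesgue_on {0..l})"
  proof -
    have "(\<lambda>s. norm (a s)) \<in> borel_measurable (lebesgue_on {0..l})"
      by (intro continuous_imp_measurable_on_sets_lebesgue continuous_intros assms(1)) simp
    then show ?thesis unfolding F_def by simp
  qed
  have "bounded (a ` {0..l})"
    using assms(1) by (intro compact_imp_bounded compact_continuous_image) auto
  then obtain C where "\<forall>y\<in>a ` {0..l}. norm y \<le> C"
    unfolding bounded_iff by blast
  then have "E \<le> ereal C"
    unfolding E_def by (intro esssup_I measF) (auto intro!: AE_I2 simp: F_def)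
  define K where "K = {s \<in> {0..l}. F s \<le> E}"
  have "closed K"
    using continuous_closed_preimage[OF contF closed_atLeastAtMost closed_atMost[of E]]
    by (simp add: K_def vimage_def Int_def)
  have "AE s in lebesgue_on {0..l}. F s \<le> E"
    unfolding E_def by (rule esssup_AE)
  then have ae: "AE s\<in>{0<..<l} in lebesgue. s \<in> K"
    by (subst (asm) AE_restrict_space_iff) (auto simp: K_def)
  have "{0<..<l} \<subseteq> K"
    using mem_closed_if_AE_lebesgue_open[OF open_greaterThanLessThan \<open>closed K\<close> ae] by blast
  then have "closure {0<..<l} \<subseteq> K"
    using \<open>closed K\<close> by (rule closure_minimal)
  then have "ereal (norm (a t)) \<le> E"
    using t \<open>l > 0\<close> by (auto simp: K_def F_def)
  moreover have "E = ereal (real_of_ereal E)"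
    using \<open>E \<le> ereal C\<close> calculation by (cases E) auto
  ultimately have "norm (a t) \<le> real_of_ereal E"
    by (metis ereal_less_eq(3))
  then show ?thesis
    by (simp add: Linf_norm_def E_def F_def[abs_def])
qed

text \<open>
  Integration by parts with the primitive \<open>exp (\<i> * s * t) / (\<i> * s)\<close> of the oscillating factor, which
  has norm \<open>1 / \<bar>s\<bar>\<close>: the two boundary terms give \<open>2 * C\<close> and the remaining integral gives the
  \<open>L\<^sup>1\<close> norm of the derivative.
\<close>

lemma oscillatory_primitive:
  fixes a a' :: "real \<Rightarrow> complex"
  assumes "continuous_on {0..l} a'" and "0 \<le> \<delta>" and "s \<noteq> 0"
    and a: "\<And>t. t \<in> {0..l} \<Longrightarrow> (a has_vector_derivative a' t) (at t within {0..l})"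
    and C: "\<And>t. t \<in> {0..l} \<Longrightarrow> norm (a t) \<le> C"
  obtains G :: "real \<Rightarrow> complex"
    where "\<And>t. t \<in> {\<delta>..l} \<Longrightarrow>
        (G has_vector_derivative a t * exp (\<i> * complex_of_real (s * t))) (at t within {\<delta>..l})"
      and "\<And>t. t \<in> {\<delta>..l} \<Longrightarrow> norm (G t - G \<delta>) \<le> (2 * C + L1_norm {0..l} a') / \<bar>s\<bar>"
proof -
  define E where "E t = exp (\<i> * complex_of_real (s * t)) / (\<i> * complex_of_real s)" for t
  have E': "(E has_vector_derivative exp (\<i> * complex_of_real (s * t))) (at t within X)" for t X
  proof -
    have "((\<lambda>z. exp (\<i> * of_real s * z) / (\<i> * of_real s)) has_field_derivative
        exp (\<i> * of_real s * of_real t)) (at (complex_of_real t))"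
      using \<open>s \<noteq> 0\<close> by (auto intro!: derivative_eq_intros)
    from has_vector_derivative_real_field[OF this] show ?thesis
      by (simp add: E_def[abs_def] mult.assoc)
  qed
  have normE: "norm (E t) = 1 / \<bar>s\<bar>" for t
    by (simp add: E_def norm_divide norm_mult)
  define J where "J t = integral {\<delta>..t} (\<lambda>u. a' u * E u)" for t
  define G where "G t = a t * E t - J t" for t
  have contE: "continuous_on X E" for X
    using \<open>s \<noteq> 0\<close> unfolding E_def by (auto intro!: continuous_intros)
  have cont: "continuous_on {\<delta>..l} (\<lambda>u. a' u * E u)"
    using assms(1,2) contE by (intro continuous_on_mult) (auto intro: continuous_on_subset)
  show ?thesis
  proof
    fix t assume t: "t \<in> {\<delta>..l}"
    have "(a has_vector_derivative a' t) (at t within {\<delta>..l})"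
      using a[of t] t \<open>0 \<le> \<delta>\<close> by (auto intro: has_vector_derivative_within_subset)
    then show "(G has_vector_derivative a t * exp (\<i> * complex_of_real (s * t)))
        (at t within {\<delta>..l})"
      unfolding G_def[abs_def] J_def
      by (auto intro!: derivative_eq_intros E' integral_has_vector_derivative[OF cont t])
    have int: "set_integrable lebesgue {0..l} (\<lambda>u. norm (a' u))"
      by (intro absolutely_integrable_continuous_real continuous_intros assms(1))
    have sub: "{\<delta>..t} \<subseteq> {0..l}" "{\<delta>..t} \<subseteq> {\<delta>..l}" using t \<open>0 \<le> \<delta>\<close> by auto
    have "norm (J t) \<le> integral {\<delta>..t} (\<lambda>u. norm (a' u) / \<bar>s\<bar>)"
      unfolding J_def
      by (intro integral_norm_bound_integral integrable_continuous_real continuous_intros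
          continuous_on_subset[OF cont sub(2)] continuous_on_subset[OF assms(1) sub(1)])
         (use \<open>s \<noteq> 0\<close> in \<open>auto simp: norm_mult normE\<close>)
    also have "\<dots> \<le> integral {0..l} (\<lambda>u. norm (a' u) / \<bar>s\<bar>)"
      using sub \<open>s \<noteq> 0\<close>
      by (intro integral_subset_le integrable_continuous_real continuous_intros
          continuous_on_subset[OF assms(1)]) auto
    also have "\<dots> = L1_norm {0..l} a' / \<bar>s\<bar>"
      by (simp add: L1_norm_def set_lebesgue_integral_eq_integral(2)[OF int])
    finally have J: "norm (J t) \<le> L1_norm {0..l} a' / \<bar>s\<bar>" .
    have "norm (a u * E u) \<le> C / \<bar>s\<bar>" if "u \<in> {0..l}" for u
      using C[OF that] by (simp add: norm_mult normE divide_right_mono)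
    then have ends: "norm (a t * E t) \<le> C / \<bar>s\<bar>" "norm (a \<delta> * E \<delta>) \<le> C / \<bar>s\<bar>"
      using t \<open>0 \<le> \<delta>\<close> by auto
    have "G t - G \<delta> = a t * E t - a \<delta> * E \<delta> - J t"
      by (simp add: G_def J_def)
    then have "norm (G t - G \<delta>) \<le> norm (a t * E t) + norm (a \<delta> * E \<delta>) + norm (J t)"
      using norm_triangle_ineq4[of "a t * E t - a \<delta> * E \<delta>" "J t"]
        norm_triangle_ineq4[of "a t * E t" "a \<delta> * E \<delta>"] by simp
    with J ends show "norm (G t - G \<delta>) \<le> (2 * C + L1_norm {0..l} a') / \<bar>s\<bar>"
      by (simp add: add_divide_distrib)
  qed
qed

section \<open>The volume of the unit ball\<close>

lemma ball_vol_pos: "ball_vol TYPE('a::euclidean_space) > 0"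
  using content_ball_pos[of 1 "0::'a"] by (simp add: ball_vol_def)

lemma ball_vol_le_cube: "ball_vol TYPE('a::euclidean_space) \<le> 2 ^ DIM('a)"
proof -
  have sub: "ball (0::'a) 1 \<subseteq> cbox (- One) One"
  proof
    fix x :: 'a assume "x \<in> ball 0 1"
    then have "\<bar>x \<bullet> i\<bar> \<le> 1" if "i \<in> Basis" for i
      using Basis_le_norm[OF that, of x] by simp
    then show "x \<in> cbox (- One) One"
      by (force simp: mem_box abs_le_iff)
  qed
  have "measure lebesgue (ball (0::'a) 1) \<le> measure lebesgue (cbox (- One) (One::'a))"
    by (rule measure_mono_fmeasurable[OF sub]) auto
  also have "\<dots> = 2 ^ DIM('a)"
    by (simp add: measure_lborel_cbox_eq algebra_simps)
  finally show ?thesis by (simp add: ball_vol_def)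
qed

section \<open>The oscillatory integral\<close>

theorem theorem2p1:
  fixes \<Omega> :: "(real ^ 'n) set"
    and f :: "real ^ 'n \<Rightarrow> real"
    and \<eta> :: "real ^ 'n \<Rightarrow> complex"
    and a a' :: "real \<Rightarrow> complex"
    and l s :: real
  assumes "open \<Omega>" and "bounded \<Omega>" and "convex \<Omega>"
    and "C2_on \<Omega> f" and "convex_on \<Omega> f"
    and "\<exists>!x. is_arg_min f (\<lambda>x. x \<in> \<Omega>) x"
    and "\<And>x. is_arg_min f (\<lambda>x. x \<in> \<Omega>) x \<Longrightarrow> f x = 0"
    and "l > 0" and "compact (sublevel \<Omega> f l)"
    and "concave_on {0..l} (\<lambda>y. measure lebesgue (sublevel \<Omega> f y))"
    and "\<And>t. t \<in> {0..l} \<Longrightarrow> (a has_vector_derivative a' t) (at t within {0..l})"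
    and "continuous_on {0..l} a'"
    and "\<And>x. x \<in> sublevel \<Omega> f l \<Longrightarrow> \<eta> x = a (f x)"
    and "s \<noteq> 0"
  shows "norm (osc_integral (sublevel \<Omega> f l) \<eta> f s)
    \<le> 5 * real CARD('n) * (Linf_norm {0..l} a + L1_norm {0..l} a')
      * measure lebesgue (sublevel \<Omega> f
          (ball_vol TYPE(real ^ 'n) powr (- 1 / real CARD('n)) / \<bar>s\<bar>))"
proof -
  define S where "S y = {x \<in> \<Omega>. f x \<le> y}" for y
  define \<mu> where "\<mu> y = measure lebesgue (S y)" for y
  define g where "g t = a t * exp (\<i> * complex_of_real (s * t))" for t
  define C where "C = Linf_norm {0..l} a"
  define L where "L = L1_norm {0..l} a'"
  define \<omega> where "\<omega> = ball_vol TYPE(real ^ 'n)"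
  define \<delta> where "\<delta> = \<omega> powr (- 1 / real CARD('n)) / \<bar>s\<bar>"

  (* The minimum value is 0, so the absolute value in the sublevel sets disappears. *)
  have f_nonneg: "f x \<ge> 0" if "x \<in> \<Omega>" for x
    using assms(6,7) that unfolding is_arg_min_def by (metis linorder_not_le)
  have sublevel: "sublevel \<Omega> f = S"
    using f_nonneg by (auto simp: sublevel_def S_def fun_eq_iff)
  have contf: "continuous_on \<Omega> f"
    using assms(4) unfolding C2_on_def
    by (meson continuous_at_imp_continuous_on has_derivative_continuous)
  have S_meas: "S y \<in> lmeasurable" for y
  proof -
    have "open (\<Omega> \<inter> f -` {y<..})"
      using contf assms(1) by (intro continuous_open_preimage) auto
    then have "\<Omega> - \<Omega> \<inter> f -` {y<..} \<in> lmeasurable"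
      using assms(1,2) by (intro fmeasurable_Diff lmeasurable_open) auto
    moreover have "\<Omega> - \<Omega> \<inter> f -` {y<..} = S y" by (auto simp: S_def)
    ultimately show ?thesis by simp
  qed
  have \<mu>_mono: "\<mu> x \<le> \<mu> y" if "x \<le> y" for x y
    unfolding \<mu>_def using that S_meas
    by (intro measure_mono_fmeasurable) (auto simp: S_def dest: fmeasurableD)
  have conta: "continuous_on {0..l} a"
    using assms(11) by (meson continuous_on_eq_continuous_within has_vector_derivative_continuous)
  have contg: "continuous_on {0..l} g"
    unfolding g_def using conta by (intro continuous_intros)
  have range: "f x \<in> {0..l}" if "x \<in> S l" for x
    using f_nonneg that by (auto simp: S_def)
  have C: "norm (a t) \<le> C" if "t \<in> {0..l}" for t
    unfolding C_def using norm_le_Linf_norm[OF conta \<open>l > 0\<close> that] .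
  have C0: "C \<ge> 0" using order_trans[OF norm_ge_zero C[of 0]] \<open>l > 0\<close> by simp
  have L0: "L \<ge> 0"
    unfolding L_def L1_norm_def set_lebesgue_integral_def by (intro integral_nonneg_AE) auto
  have norm_g: "norm (g t) \<le> C" if "t \<in> {0..l}" for t
    using C[OF that] by (simp add: g_def norm_mult)

  have int: "set_integrable lebesgue (S l) (\<lambda>x. g (f x))"
  proof -
    have "continuous_on (S l) (\<lambda>x. g (f x))"
      by (rule continuous_on_compose2[OF contg])
         (use range contf in \<open>auto simp: S_def intro: continuous_on_subset\<close>)
    then have "integrable lborel (\<lambda>x. indicator (S l) x *\<^sub>R g (f x))"
      using assms(9) by (intro borel_integrable_compact) (simp_all add: sublevel)
    then show ?thesis
      unfolding set_integrable_def by (simp add: integrable_completion borel_measurable_integrable)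
  qed
  have I: "osc_integral (S l) \<eta> f s = (LINT x:S l|lebesgue. g (f x))"
    unfolding osc_integral_def
    by (rule set_lebesgue_integral_cong) (use S_meas assms(13) sublevel in \<open>auto simp: g_def\<close>)
  have bound: "norm (LINT x:S y|lebesgue. g (f x)) \<le> C * \<mu> y" if "y \<le> l" for y
    unfolding \<mu>_def
  proof (rule set_integral_norm_le_const[OF S_meas])
    have "S y \<subseteq> S l" using that by (auto simp: S_def)
    then show "set_integrable lebesgue (S y) (\<lambda>x. g (f x))"
      using int S_meas by (auto intro: set_integrable_subset)
    show "norm (g (f x)) \<le> C" if "x \<in> S y" for x
      using \<open>S y \<subseteq> S l\<close> that range norm_g by blast
  qed

  have \<omega>: "\<omega> > 0" "\<omega> \<le> 2 ^ CARD('n)"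
    unfolding \<omega>_def using ball_vol_pos ball_vol_le_cube[where 'a = "real ^ 'n"] by auto
  have \<delta>0: "\<delta> > 0" using \<omega> assms(14) by (simp add: \<delta>_def)
  (* The factor that turns the decay 1 / \<bar>s\<bar> of the primitive and the slope \<mu> \<delta> / \<delta> into a multiple
     of \<mu> \<delta>. *)
  have rate: "1 / (\<bar>s\<bar> * \<delta>) \<le> 2"
  proof -
    have "1 / (\<bar>s\<bar> * \<delta>) = \<omega> powr (1 / real CARD('n))"
      using \<omega> assms(14) by (simp add: \<delta>_def powr_minus_divide)
    also have "\<dots> \<le> (2 ^ CARD('n)) powr (1 / real CARD('n))"
      using \<omega> by (intro powr_mono2) auto
    also have "\<dots> = 2"
      by (simp add: powr_realpow[symmetric] powr_powr)
    finally show ?thesis .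
  qed

  have "norm (osc_integral (S l) \<eta> f s) \<le> 5 * (C + L) * \<mu> \<delta>"
  proof (cases "l \<le> \<delta>")
    case True
    have "C * \<mu> l \<le> C * \<mu> \<delta>" using \<mu>_mono[OF True] C0 by (rule mult_left_mono)
    also have "\<dots> \<le> 5 * (C + L) * \<mu> \<delta>"
      using C0 L0 by (intro mult_right_mono) (auto simp: \<mu>_def)
    finally show ?thesis unfolding I using bound[of l] by simp
  next
    case False
    define P where "P = {x \<in> \<Omega>. \<delta> < f x \<and> f x \<le> l}"
    have P_eq: "P = S l - S \<delta>" by (auto simp: P_def S_def)
    have sets: "P \<in> sets lebesgue" "S \<delta> \<in> sets lebesgue"
      unfolding P_eq using S_meas by auto
    have Sl: "S l = S \<delta> \<union> P" "S \<delta> \<inter> P = {}"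
      using False by (auto simp: P_def S_def)
    have ints: "set_integrable lebesgue P (\<lambda>x. g (f x))"
      "set_integrable lebesgue (S \<delta>) (\<lambda>x. g (f x))"
      using int sets Sl(1) by (auto intro: set_integrable_subset)
    obtain G where G: "\<And>t. t \<in> {\<delta>..l} \<Longrightarrow> (G has_vector_derivative g t) (at t within {\<delta>..l})"
      "\<And>t. t \<in> {\<delta>..l} \<Longrightarrow> norm (G t - G \<delta>) \<le> (2 * C + L) / \<bar>s\<bar>"
      using oscillatory_primitive[OF assms(12) less_imp_le[OF \<delta>0] assms(14,11) C]
      unfolding g_def L_def by blast
    have "norm (LINT x:P|lebesgue. g (f x)) \<le> (2 * C + L) / \<bar>s\<bar> * \<mu> \<delta> / \<delta>"
      unfolding P_def \<mu>_def S_def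
    proof (rule pushforward_integral_bound[where G = G])
      show "continuous_on {\<delta>..l} g"
        using contg \<delta>0 by (auto intro: continuous_on_subset)
    qed (use assms(10) S_meas \<delta>0 False ints(1) G in
        \<open>auto simp: sublevel P_def S_def[symmetric]\<close>)
    also have "\<dots> = (1 / (\<bar>s\<bar> * \<delta>)) * ((2 * C + L) * \<mu> \<delta>)" by simp
    also have "\<dots> \<le> 2 * ((2 * C + L) * \<mu> \<delta>)"
      using rate C0 L0 by (intro mult_right_mono) (auto simp: \<mu>_def)
    finally have tail: "norm (LINT x:P|lebesgue. g (f x)) \<le> 2 * ((2 * C + L) * \<mu> \<delta>)" .
    have "osc_integral (S l) \<eta> f s
        = (LINT x:S \<delta>|lebesgue. g (f x)) + (LINT x:P|lebesgue. g (f x))"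
      unfolding I using set_integral_Un[OF Sl(2) ints(2,1)] by (simp add: Sl(1))
    then have "norm (osc_integral (S l) \<eta> f s) \<le> C * \<mu> \<delta> + 2 * ((2 * C + L) * \<mu> \<delta>)"
      using norm_triangle_mono[OF bound[of \<delta>] tail] False by simp
    also have "\<dots> \<le> 5 * (C + L) * \<mu> \<delta>"
      using L0 by (simp add: algebra_simps \<mu>_def)
    finally show ?thesis .
  qed
  also have "\<dots> \<le> 5 * real CARD('n) * (C + L) * \<mu> \<delta>"
  proof -
    have "1 * (5 * (C + L) * \<mu> \<delta>) \<le> real CARD('n) * (5 * (C + L) * \<mu> \<delta>)"
      using C0 L0 by (intro mult_right_mono) (auto simp: \<mu>_def Suc_leI)
    then show ?thesis by (simp add: algebra_simps)
  qed
  finally show ?thesis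
    by (simp add: sublevel \<mu>_def \<delta>_def \<omega>_def C_def L_def)
qed

end
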